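(* Let $n\ge 2$ and let $b_1,b_2\in\mathbb{R}$. Let $\mathbf{S}_{n,2}$ be the $n\times n$ discrete Schrödinger matrix with diagonal entries $b_1,b_2,0,\dots,0$, and let $\mathbf{F}_n$ be the $n\times n$ free discrete Schrödinger matrix. Let $\lambda_1<\lambda_2<\cdots<\lambda_n$ denote the eigenvalues of $\mathbf{F}_n$ and let $\tilde\lambda_1<\tilde\lambda_2<\cdots<\tilde\lambda_n$ denote the eigenvalues of $\mathbf{S}_{n,2}$. Suppose that $\lambda_k=\tilde\lambda_k$ and $\lambda_{k+1}=\tilde\lambda_{k+1}$ for some $k\in\{1,2,\dots,n-1\}$. Then $b_1=0$ and $b_2=0$, i.e. $\mathbf{S}_{n,2}=\mathbf{F}_n$.
   Context: The $n\times n$ discrete Schrödinger matrix with real diagonal entries $d_1,\dots,d_n$ is the real symmetric tridiagonal matrix whose $(k,k)$ entry is $d_k$ for $1\le k\le n$, whose $(k,k+1)$ and $(k+1,k)$ entries equal $1$ for $1\le k\le n-1$, and whose other entries are all $0$. The matrix $\mathbf{S}_{n,2}$ is the one with $d_1=b_1$, $d_2=b_2$ and $d_j=0$ for $3\le j\le n$. The free discrete Schrödinger matrix $\mathbf{F}_n$ is the one with all $d_j=0$. Every such matrix has $n$ distinct real eigenvalues, so its eigenvalues can be listed in strictly increasing order. *)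

theory Defs
  imports "Jordan_Normal_Form.Char_Poly"
begin

text \<open>The diagonal entries are numbered from 1, as in \<open>d\<^sub>1, \<dots>, d\<^sub>n\<close>, whereas the
  rows and columns of \<^typ>\<open>real mat\<close> are numbered from 0; hence the shift \<open>d (i + 1)\<close>.\<close>

definition schroedinger_mat :: "nat \<Rightarrow> (nat \<Rightarrow> real) \<Rightarrow> real mat" where
  "schroedinger_mat n d = mat n n (\<lambda>(i, j).
     if i = j then d (i + 1)
     else if j = i + 1 \<or> i = j + 1 then 1
     else 0)"

definition free_schroedinger_mat :: "nat \<Rightarrow> real mat" where
  "free_schroedinger_mat n = schroedinger_mat n (\<lambda>_. 0)"

definition schroedinger_mat2 :: "nat \<Rightarrow> real \<Rightarrow> real \<Rightarrow> real mat" where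
  "schroedinger_mat2 n b1 b2 =
     schroedinger_mat n (\<lambda>j. if j = 1 then b1 else if j = 2 then b2 else 0)"

text \<open>\<open>lists_eigenvalues n A ev\<close> says that \<open>ev 1 < ev 2 < \<dots> < ev n\<close> are exactly the
  eigenvalues of \<open>A\<close>. The values of \<open>ev\<close> outside \<open>{1..n}\<close> are irrelevant.\<close>

definition lists_eigenvalues :: "nat \<Rightarrow> real mat \<Rightarrow> (nat \<Rightarrow> real) \<Rightarrow> bool" where
  "lists_eigenvalues n A ev \<longleftrightarrow>
     strict_mono_on {1..n} ev \<and> ev ` {1..n} = {x. eigenvalue A x}"

end

theory Submission
  imports Defs
begin

text \<open>Pairing an eigenvector of \<open>F\<close> with one of \<open>S\<close> for a common eigenvalue \<open>x\<close> and using
  symmetry gives \<open>b1 + b2 x (x - b1) = 0\<close>. If this holds for two distinct \<open>x = \<lambda>, \<mu>\<close> and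
  \<open>(b1, b2) \<noteq> 0\<close>, then \<open>b1 = \<lambda> + \<mu>\<close> and \<open>b1 = b2 \<lambda> \<mu>\<close>. The spectrum of \<open>F\<close> is symmetric about 0,
  so consecutive eigenvalues of opposite sign would sum to 0, which is impossible; hence \<open>b1\<close> and
  \<open>b2\<close> have the same sign. But then every eigenvalue moves strictly, by the Courant-Fischer
  argument, contradicting \<open>\<lambda>\<^sub>k = \<lambda>'\<^sub>k\<close>.\<close>

section \<open>Scalar products, symmetric matrices and homogeneous linear systems\<close>

lemma scalar_prod_vec_sum:
  fixes v :: "'i \<Rightarrow> real vec"
  assumes "w \<in> carrier_vec n" "\<And>i. i \<in> I \<Longrightarrow> v i \<in> carrier_vec n"
  shows "vec n (\<lambda>r. \<Sum>i\<in>I. a i * v i $ r) \<bullet> w = (\<Sum>i\<in>I. a i * (v i \<bullet> w))"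
proof -
  have "vec n (\<lambda>r. \<Sum>i\<in>I. a i * v i $ r) \<bullet> w = (\<Sum>r<n. \<Sum>i\<in>I. a i * v i $ r * w $ r)"
    using assms by (simp add: scalar_prod_def sum_distrib_right lessThan_atLeast0)
  also have "\<dots> = (\<Sum>i\<in>I. \<Sum>r<n. a i * v i $ r * w $ r)" by (rule sum.swap)
  also have "\<dots> = (\<Sum>i\<in>I. a i * (v i \<bullet> w))"
    using assms by (simp add: scalar_prod_def sum_distrib_left lessThan_atLeast0 mult.assoc)
  finally show ?thesis .
qed

lemma scalar_prod_orthogonal_sums:
  fixes v :: "'i \<Rightarrow> real vec"
  assumes fin: "finite I" and v: "\<And>i. i \<in> I \<Longrightarrow> v i \<in> carrier_vec n"
    and orth: "\<And>i j. i \<in> I \<Longrightarrow> j \<in> I \<Longrightarrow> i \<noteq> j \<Longrightarrow> v i \<bullet> v j = 0"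
  shows "vec n (\<lambda>r. \<Sum>i\<in>I. a i * v i $ r) \<bullet> vec n (\<lambda>r. \<Sum>i\<in>I. c i * v i $ r)
    = (\<Sum>i\<in>I. a i * c i * (v i \<bullet> v i))"
proof -
  have *: "v i \<bullet> vec n (\<lambda>r. \<Sum>j\<in>I. c j * v j $ r) = c i * (v i \<bullet> v i)" if i: "i \<in> I" for i
  proof -
    have "v i \<bullet> vec n (\<lambda>r. \<Sum>j\<in>I. c j * v j $ r) = (\<Sum>j\<in>I. c j * (v j \<bullet> v i))"
      using v[OF i] v by (subst comm_scalar_prod[of _ n]) (auto simp: scalar_prod_vec_sum)
    also have "\<dots> = (\<Sum>j\<in>I. if j = i then c i * (v i \<bullet> v i) else 0)"
      by (rule sum.cong) (auto simp: orth i)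
    finally show ?thesis using fin i by simp
  qed
  show ?thesis
    by (subst scalar_prod_vec_sum) (auto simp: v * mult.assoc intro!: sum.cong)
qed

lemma scalar_prod_self_pos:
  fixes v :: "real vec"
  assumes v: "v \<in> carrier_vec n" "v \<noteq> 0\<^sub>v n"
  shows "0 < v \<bullet> v"
proof -
  obtain i where "i < n" "v $ i \<noteq> 0" using v by (auto simp: vec_eq_iff)
  hence "0 < (\<Sum>j<n. v $ j * v $ j)"
    by (intro sum_pos2[of _ i]) (auto simp: zero_less_mult_iff)
  thus ?thesis using v by (simp add: scalar_prod_def atLeast0LessThan)
qed

lemma symmetric_mat_scalar_prod:
  fixes A :: "real mat"
  assumes A: "A \<in> carrier_mat n n" "A\<^sup>T = A" and "u \<in> carrier_vec n" "w \<in> carrier_vec n"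
  shows "(A *\<^sub>v u) \<bullet> w = u \<bullet> (A *\<^sub>v w)"
  using transpose_vec_mult_scalar[of A n n w u] assms
  by (metis comm_scalar_prod mult_mat_vec_carrier)

lemma eigenvectors_orthogonal:
  fixes A :: "real mat"
  assumes A: "A \<in> carrier_mat n n" "A\<^sup>T = A"
    and "eigenvector A v x" "eigenvector A w y" "x \<noteq> y"
  shows "v \<bullet> w = 0"
proof -
  have v: "v \<in> carrier_vec n" "A *\<^sub>v v = x \<cdot>\<^sub>v v" and w: "w \<in> carrier_vec n" "A *\<^sub>v w = y \<cdot>\<^sub>v w"
    using assms by (auto simp: eigenvector_def)
  have "x * (v \<bullet> w) = y * (v \<bullet> w)"
    using symmetric_mat_scalar_prod[OF A v(1) w(1)] v w by simp
  with \<open>x \<noteq> y\<close> show ?thesis by simp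
qed

text \<open>Eigenvectors for distinct eigenvalues of a symmetric matrix are orthogonal, so all cross
  terms vanish. The eigenvectors are not normalised, hence the weights
  \<open>v i \<bullet> v i\<close>.\<close>

lemma eigenvector_combination:
  fixes A :: "real mat" and v :: "'i \<Rightarrow> real vec"
  assumes A: "A \<in> carrier_mat n n" "A\<^sup>T = A" and fin: "finite I"
    and ev: "\<And>i. i \<in> I \<Longrightarrow> eigenvector A (v i) (e i)" and inj: "inj_on e I"
    and u: "u = vec n (\<lambda>r. \<Sum>i\<in>I. a i * v i $ r)"
  shows "u \<bullet> u = (\<Sum>i\<in>I. (a i)\<^sup>2 * (v i \<bullet> v i))"
    and "u \<bullet> (A *\<^sub>v u) = (\<Sum>i\<in>I. e i * ((a i)\<^sup>2 * (v i \<bullet> v i)))"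
proof -
  have v: "v i \<in> carrier_vec n" "A *\<^sub>v v i = e i \<cdot>\<^sub>v v i" if "i \<in> I" for i
    using ev[OF that] A by (auto simp: eigenvector_def)
  have orth: "v i \<bullet> v j = 0" if "i \<in> I" "j \<in> I" "i \<noteq> j" for i j
    using eigenvectors_orthogonal[OF A ev[OF that(1)] ev[OF that(2)]] inj that
    by (auto simp: inj_on_def)
  note sums = scalar_prod_orthogonal_sums[of I v n, OF fin v(1) orth]
  show "u \<bullet> u = (\<Sum>i\<in>I. (a i)\<^sup>2 * (v i \<bullet> v i))"
    unfolding u by (subst sums) (auto simp: power2_eq_square)
  have Au: "A *\<^sub>v u = vec n (\<lambda>r. \<Sum>i\<in>I. (e i * a i) * v i $ r)"
  proof (rule eq_vecI)
    fix r assume "r < dim_vec (vec n (\<lambda>r. \<Sum>i\<in>I. (e i * a i) * v i $ r))"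
    hence r: "r < n" by simp
    \<comment> \<open>Each entry of the product is a scalar product with a row of \<open>A\<close>,
      so it is linear in \<open>u\<close> and can be pushed through the sum onto each
      eigenvector.\<close>
    have "(A *\<^sub>v u) $ r = u \<bullet> row A r"
      using r A by (simp add: u comm_scalar_prod[of _ n])
    also have "\<dots> = (\<Sum>i\<in>I. a i * (v i \<bullet> row A r))"
      unfolding u by (rule scalar_prod_vec_sum) (use A r v in auto)
    also have "\<dots> = (\<Sum>i\<in>I. a i * ((A *\<^sub>v v i) $ r))"
      using A r v(1) by (intro sum.cong) (auto simp: comm_scalar_prod[of _ n])
    also have "\<dots> = (\<Sum>i\<in>I. (e i * a i) * v i $ r)"
    proof (intro sum.cong refl)
      fix i assume "i \<in> I"
      from v[OF this] r show "a i * ((A *\<^sub>v v i) $ r) = (e i * a i) * v i $ r" by simp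
    qed
    finally show "(A *\<^sub>v u) $ r = vec n (\<lambda>r. \<Sum>i\<in>I. (e i * a i) * v i $ r) $ r"
      using r by simp
  qed (use A in auto)
  show "u \<bullet> (A *\<^sub>v u) = (\<Sum>i\<in>I. e i * ((a i)\<^sup>2 * (v i \<bullet> v i)))"
    unfolding Au unfolding u by (subst sums) (auto simp: power2_eq_square intro!: sum.cong)
qed

text \<open>A homogeneous system of \<open>n\<close> equations in \<open>n + 1\<close> unknowns:
  padding it with a zero row gives a square matrix, singular by Laplace expansion along that row.
  This is the dimension count that makes two spans meet.\<close>

lemma underdetermined_kernel:
  fixes f :: "nat \<Rightarrow> nat \<Rightarrow> real"
  obtains x i where "i \<le> n" "x i \<noteq> 0" "\<And>r. r < n \<Longrightarrow> (\<Sum>c\<le>n. f r c * x c) = 0"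
proof -
  let ?M = "mat (Suc n) (Suc n) (\<lambda>(r, c). if r < n then f r c else 0)"
  have "det ?M = (\<Sum>j<Suc n. ?M $$ (n, j) * cofactor ?M n j)"
    by (rule laplace_expansion_row) auto
  also have "\<dots> = 0" by (rule sum.neutral) auto
  finally obtain x where x: "x \<in> carrier_vec (Suc n)" "x \<noteq> 0\<^sub>v (Suc n)"
      "?M *\<^sub>v x = 0\<^sub>v (Suc n)"
    using det_0_iff_vec_prod_zero[of ?M "Suc n"] by auto
  obtain i where "i < Suc n" "x $ i \<noteq> 0" using x(1,2) by (auto simp: vec_eq_iff)
  moreover have "(\<Sum>c\<le>n. f r c * x $ c) = 0" if "r < n" for r
  proof -
    have "(?M *\<^sub>v x) $ r = (\<Sum>c\<le>n. f r c * x $ c)"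
      using that x(1) by (simp add: scalar_prod_def atLeast0LessThan lessThan_Suc_atMost)
    with x(3) that show ?thesis by simp
  qed
  ultimately show thesis using that[of i "\<lambda>c. x $ c"] by simp
qed

section \<open>Discrete Schroedinger matrices and their eigenvectors\<close>

lemma schroedinger_mat_carrier [simp]: "schroedinger_mat n d \<in> carrier_mat n n"
  by (simp add: schroedinger_mat_def)

lemma transpose_schroedinger_mat: "(schroedinger_mat n d)\<^sup>T = schroedinger_mat n d"
  by (rule eq_matI) (auto simp: schroedinger_mat_def)

lemma schroedinger_mat_mult_vec:
  assumes v: "v \<in> carrier_vec n" and i: "i < n"
  shows "(schroedinger_mat n d *\<^sub>v v) $ i = d (i + 1) * v $ i
    + (if i = 0 then 0 else v $ (i - 1)) + (if i + 1 < n then v $ (i + 1) else 0)"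
proof -
  have "(schroedinger_mat n d *\<^sub>v v) $ i
      = (\<Sum>j<n. (if i = j then d (i + 1) else if j = i + 1 \<or> i = j + 1 then 1 else 0) * v $ j)"
    using assms by (simp add: schroedinger_mat_def scalar_prod_def atLeast0LessThan)
  \<comment> \<open>Truncated subtraction makes \<open>i - 1\<close> equal to \<open>i\<close> when
    \<open>i = 0\<close>; the inner conditional then removes the spurious left neighbour. The right
    neighbour drops out by itself when \<open>i + 1\<close> is outside the range.\<close>
  also have "\<dots> = (\<Sum>j<n. (if j = i then d (i + 1) * v $ i else 0)
      + (if j = i - 1 then if i = 0 then 0 else v $ (i - 1) else 0)
      + (if j = i + 1 then v $ (i + 1) else 0))"
    by (rule sum.cong) auto
  also have "\<dots> = d (i + 1) * v $ i
    + (if i = 0 then 0 else v $ (i - 1)) + (if i + 1 < n then v $ (i + 1) else 0)"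
    using i by (simp add: sum.distrib)
  finally show ?thesis .
qed

lemma schroedinger_eigenvector_eq:
  assumes "eigenvector (schroedinger_mat n d) v x" "i < n"
  shows "x * v $ i = d (i + 1) * v $ i
    + (if i = 0 then 0 else v $ (i - 1)) + (if i + 1 < n then v $ (i + 1) else 0)"
proof -
  have v: "v \<in> carrier_vec n" "schroedinger_mat n d *\<^sub>v v = x \<cdot>\<^sub>v v"
    using assms by (auto simp: eigenvector_def schroedinger_mat_def)
  have "x * v $ i = (schroedinger_mat n d *\<^sub>v v) $ i"
    unfolding v(2) using v(1) assms(2) by simp
  thus ?thesis using schroedinger_mat_mult_vec[OF v(1) assms(2), of d] by simp
qed

text \<open>The eigenvalue equation is a three-term recurrence in which the next entry has
  coefficient 1, so a zero first entry would force the whole vector to vanish.\<close>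

lemma schroedinger_eigenvector_first_nonzero:
  assumes ev: "eigenvector (schroedinger_mat n d) v x"
  shows "v $ 0 \<noteq> 0"
proof
  assume 0: "v $ 0 = 0"
  have "v $ i = 0" if "i < n" for i
    using that
  proof (induction i rule: less_induct)
    case (less i)
    show ?case
    proof (cases i)
      case (Suc j)
      \<comment> \<open>Row \<open>j = i - 1\<close> expresses \<open>v $ i\<close> through
        \<open>v $ j\<close> and \<open>v $ (j - 1)\<close>; the latter is absent for
        \<open>j = 0\<close>, hence the disjunction.\<close>
      have "v $ j = 0" "j = 0 \<or> v $ (j - 1) = 0"
        using less Suc by auto
      thus ?thesis
        using schroedinger_eigenvector_eq[OF ev, of j] less.prems Suc by (auto split: if_splits)
    qed (simp add: 0)
  qed
  moreover have "v \<in> carrier_vec n" "v \<noteq> 0\<^sub>v n"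
    using ev by (auto simp: eigenvector_def schroedinger_mat_def)
  ultimately show False by (auto simp: vec_eq_iff)
qed

text \<open>The off-diagonal contributions are the same for \<open>d\<close> and \<open>d'\<close>
  and cancel. Two vectors are allowed so that the identity serves both the quadratic form of one
  vector and the pairing of two eigenvectors.\<close>

lemma schroedinger_quadratic_form_diff:
  assumes "u \<in> carrier_vec n" and w: "w \<in> carrier_vec n"
  shows "u \<bullet> (schroedinger_mat n d' *\<^sub>v w) - u \<bullet> (schroedinger_mat n d *\<^sub>v w)
    = (\<Sum>r<n. (d' (r + 1) - d (r + 1)) * (u $ r * w $ r))"
proof -
  have "u \<bullet> (schroedinger_mat n d' *\<^sub>v w) - u \<bullet> (schroedinger_mat n d *\<^sub>v w)
    = (\<Sum>r<n. u $ r * (schroedinger_mat n d' *\<^sub>v w) $ r - u $ r * (schroedinger_mat n d *\<^sub>v w) $ r)"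
    unfolding scalar_prod_def
    by (simp add: atLeast0LessThan sum_subtractf schroedinger_mat_def)
  also have "\<dots> = (\<Sum>r<n. (d' (r + 1) - d (r + 1)) * (u $ r * w $ r))"
    by (intro sum.cong refl) (simp add: schroedinger_mat_mult_vec[OF w] algebra_simps)
  finally show ?thesis .
qed

text \<open>Conjugation by the diagonal matrix with entries \<open>(- 1) ^ i\<close> flips the
  off-diagonal signs; negation restores them and flips the diagonal. For zero diagonal this is the
  symmetry of the spectrum about 0.\<close>

lemma eigenvalue_schroedinger_neg:
  assumes "eigenvalue (schroedinger_mat n d) x"
  shows "eigenvalue (schroedinger_mat n (\<lambda>i. - d i)) (- x)"
proof -
  obtain v where ev: "eigenvector (schroedinger_mat n d) v x"
    using assms by (auto simp: eigenvalue_def)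
  hence v: "v \<in> carrier_vec n" "v \<noteq> 0\<^sub>v n"
    by (auto simp: eigenvector_def schroedinger_mat_def)
  define w where "w = vec n (\<lambda>i. (- 1) ^ i * v $ i)"
  have w: "w \<in> carrier_vec n" by (simp add: w_def)
  have "w \<noteq> 0\<^sub>v n" using v by (auto simp: w_def vec_eq_iff)
  moreover have "schroedinger_mat n (\<lambda>i. - d i) *\<^sub>v w = (- x) \<cdot>\<^sub>v w"
  proof (rule eq_vecI)
    fix i assume "i < dim_vec ((- x) \<cdot>\<^sub>v w)"
    hence i: "i < n" by (simp add: w_def)
    have "(- x) * w $ i = - ((- 1) ^ i * (x * v $ i))"
      using i by (simp add: w_def)
    also have "\<dots> = (schroedinger_mat n (\<lambda>i. - d i) *\<^sub>v w) $ i"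
      unfolding schroedinger_eigenvector_eq[OF ev i] schroedinger_mat_mult_vec[OF w i]
      using i by (cases i) (auto simp: w_def algebra_simps)
    finally show "(schroedinger_mat n (\<lambda>i. - d i) *\<^sub>v w) $ i = ((- x) \<cdot>\<^sub>v w) $ i"
      using i w by simp
  qed (simp add: w_def schroedinger_mat_def)
  ultimately show ?thesis
    using w by (auto simp: eigenvalue_def eigenvector_def schroedinger_mat_def)
qed

section \<open>Strict monotonicity of the eigenvalues in the diagonal\<close>

lemma lists_eigenvalues_eigenvector:
  assumes "lists_eigenvalues n A e"
  obtains v where "\<And>i. i \<in> {1..n} \<Longrightarrow> eigenvector A (v i) (e i)"
proof -
  have "\<forall>i\<in>{1..n}. \<exists>v. eigenvector A v (e i)"
    using assms by (force simp: lists_eigenvalues_def eigenvalue_def)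
  thus thesis using that by metis
qed

text \<open>Courant-Fischer: the span of the top \<open>n - k + 1\<close> eigenvectors for \<open>d\<close> meets the span of the
  bottom \<open>k\<close> eigenvectors for \<open>d'\<close>. Strictness comes from the nonzero first entries.\<close>

lemma schroedinger_eigenvalue_strict_mono:
  assumes e: "lists_eigenvalues n (schroedinger_mat n d) e"
    and e': "lists_eigenvalues n (schroedinger_mat n d') e'"
    and le: "\<And>i. i \<in> {1..n} \<Longrightarrow> d i \<le> d' i" and less: "d 1 < d' 1" and k: "k \<in> {1..n}"
  shows "e k < e' k"
proof (rule ccontr)
  assume "\<not> e k < e' k"
  hence ek: "e' k \<le> e k" by simp
  let ?A = "schroedinger_mat n d" and ?B = "schroedinger_mat n d'"
  obtain v where v: "\<And>i. i \<in> {1..n} \<Longrightarrow> eigenvector ?A (v i) (e i)"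
    using lists_eigenvalues_eigenvector[OF e] by metis
  obtain w where w: "\<And>i. i \<in> {1..n} \<Longrightarrow> eigenvector ?B (w i) (e' i)"
    using lists_eigenvalues_eigenvector[OF e'] by metis
  have mono: "strict_mono_on {1..n} e" and mono': "strict_mono_on {1..n} e'"
    using e e' by (auto simp: lists_eigenvalues_def)
  \<comment> \<open>The \<open>n + 1\<close> vectors \<open>w 1, ..., w k, v k, ..., v n\<close>
    live in dimension \<open>n\<close>, so they satisfy a nontrivial relation. Indices
    \<open>c < k\<close> stand for \<open>w (c + 1)\<close>, the others for \<open>v c\<close>. The
    vector \<open>u\<close> below may be zero a priori; the contradiction is that all coefficients
    \<open>x c\<close> vanish.\<close>
  obtain x i0 where i0: "i0 \<le> n" "x i0 \<noteq> 0"
    and x: "\<And>r. r < n \<Longrightarrow> (\<Sum>c\<le>n. (if c < k then w (c + 1) $ r else v c $ r) * x c) = 0"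
    using underdetermined_kernel[of n "\<lambda>r c. if c < k then w (c + 1) $ r else v c $ r"] by blast
  define u where "u = vec n (\<lambda>r. \<Sum>c\<in>{k..n}. x c * v c $ r)"
  have u_carrier: "u \<in> carrier_vec n" by (simp add: u_def)
  have u_alt: "u = vec n (\<lambda>r. \<Sum>c<k. (- x c) * w (c + 1) $ r)"
  proof (rule eq_vecI)
    fix r assume "r < dim_vec (vec n (\<lambda>r. \<Sum>c<k. (- x c) * w (c + 1) $ r))"
    hence r: "r < n" by simp
    have "{..n} = {..<k} \<union> {k..n}" using k by auto
    hence "(\<Sum>c<k. w (c + 1) $ r * x c) + (\<Sum>c\<in>{k..n}. v c $ r * x c) = 0"
      using x[OF r] by (simp add: sum.union_disjoint ivl_disj_int)
    thus "u $ r = vec n (\<lambda>r. \<Sum>c<k. (- x c) * w (c + 1) $ r) $ r"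
      using r by (simp add: u_def sum_negf mult.commute)
  qed (simp add: u_def)
  have inj: "inj_on e {k..n}"
    using strict_mono_on_imp_inj_on[OF mono] k by (auto intro: inj_on_subset)
  have uA: "u \<bullet> u = (\<Sum>i\<in>{k..n}. (x i)\<^sup>2 * (v i \<bullet> v i))"
    "u \<bullet> (?A *\<^sub>v u) = (\<Sum>i\<in>{k..n}. e i * ((x i)\<^sup>2 * (v i \<bullet> v i)))"
    using eigenvector_combination[OF schroedinger_mat_carrier transpose_schroedinger_mat
        finite_atLeastAtMost v inj u_def] k by auto
  have inj': "inj_on (\<lambda>c. e' (c + 1)) {..<k}"
  proof (rule inj_onI)
    fix i j assume "i \<in> {..<k}" "j \<in> {..<k}" "e' (i + 1) = e' (j + 1)"
    thus "i = j"
      using inj_onD[OF strict_mono_on_imp_inj_on[OF mono'], of "i + 1" "j + 1"] k by simp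
  qed
  have w_shift: "eigenvector ?B (w (c + 1)) (e' (c + 1))" if "c \<in> {..<k}" for c
    using w[of "c + 1"] that k by simp
  have uB: "u \<bullet> u = (\<Sum>c<k. (x c)\<^sup>2 * (w (c + 1) \<bullet> w (c + 1)))"
    "u \<bullet> (?B *\<^sub>v u) = (\<Sum>c<k. e' (c + 1) * ((x c)\<^sup>2 * (w (c + 1) \<bullet> w (c + 1))))"
    using eigenvector_combination[of ?B n "{..<k}" "\<lambda>c. w (c + 1)" "\<lambda>c. e' (c + 1)" u "\<lambda>c. - x c",
        OF schroedinger_mat_carrier transpose_schroedinger_mat finite_lessThan w_shift inj' u_alt]
    by simp_all
  have diff: "u \<bullet> (?B *\<^sub>v u) - u \<bullet> (?A *\<^sub>v u) = (\<Sum>r<n. (d' (r + 1) - d (r + 1)) * (u $ r * u $ r))"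
    by (rule schroedinger_quadratic_form_diff[OF u_carrier u_carrier])
  have pos_v: "0 < v i \<bullet> v i" if "i \<in> {1..n}" for i
    using v[OF that] by (auto simp: eigenvector_def schroedinger_mat_def intro!: scalar_prod_self_pos)
  have pos_w: "0 < w i \<bullet> w i" if "i \<in> {1..n}" for i
    using w[OF that] by (auto simp: eigenvector_def schroedinger_mat_def intro!: scalar_prod_self_pos)
  \<comment> \<open>Expansion in the \<open>v i\<close> shows that \<open>?P\<close> is
    \<open>u \<bullet> (?A *\<^sub>v u) - e k * (u \<bullet> u)\<close>, and \<open>?Q\<close> is
    the gain from \<open>?A\<close> to \<open>?B\<close>. Expansion in the \<open>w i\<close>, whose
    eigenvalues are at most \<open>e' k \<le> e k\<close>, bounds the total \<open>?P + ?Q\<close>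
    by 0. All summands are nonnegative, so each one vanishes.\<close>
  let ?P = "\<Sum>i\<in>{k..n}. (e i - e k) * ((x i)\<^sup>2 * (v i \<bullet> v i))"
  let ?Q = "\<Sum>r<n. (d' (r + 1) - d (r + 1)) * (u $ r * u $ r)"
  have "u \<bullet> (?B *\<^sub>v u) \<le> (\<Sum>c<k. e k * ((x c)\<^sup>2 * (w (c + 1) \<bullet> w (c + 1))))"
    unfolding uB
  proof (intro sum_mono mult_right_mono)
    fix c assume c: "c \<in> {..<k}"
    have "e' (c + 1) \<le> e' k"
      using strict_mono_on_leD[OF mono', of "c + 1" k] c k by auto
    thus "e' (c + 1) \<le> e k" using ek by simp
    show "0 \<le> (x c)\<^sup>2 * (w (c + 1) \<bullet> w (c + 1))"
      using pos_w[of "c + 1"] c k by (intro mult_nonneg_nonneg) auto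
  qed
  also have "\<dots> = e k * (u \<bullet> u)" by (simp add: uB sum_distrib_left)
  finally have "?P + ?Q \<le> 0"
    unfolding diff[symmetric] uA by (simp add: left_diff_distrib sum_subtractf sum_distrib_left)
  moreover have P: "0 \<le> (e i - e k) * ((x i)\<^sup>2 * (v i \<bullet> v i))" if "i \<in> {k..n}" for i
    using strict_mono_on_leD[OF mono, of k i] pos_v[of i] that k
    by (intro mult_nonneg_nonneg) auto
  moreover have Q: "0 \<le> (d' (r + 1) - d (r + 1)) * (u $ r * u $ r)" if "r < n" for r
    using le[of "r + 1"] that by (simp add: mult_nonneg_nonneg)
  moreover have "0 \<le> ?P" "0 \<le> ?Q" using P Q by (metis (no_types, lifting) sum_nonneg lessThan_iff)+
  ultimately have "?P = 0" "?Q = 0" by linarith+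
  have P0: "(e i - e k) * ((x i)\<^sup>2 * (v i \<bullet> v i)) = 0" if "i \<in> {k..n}" for i
    by (rule sum_nonneg_0[OF finite_atLeastAtMost P \<open>?P = 0\<close> that])
  have Q0: "(d' (r + 1) - d (r + 1)) * (u $ r * u $ r) = 0" if "r < n" for r
    by (rule sum_nonneg_0[OF finite_lessThan Q \<open>?Q = 0\<close>]) (use that in simp_all)
  \<comment> \<open>The strict increase of the first diagonal entry kills \<open>u $ 0\<close>, and
    the strict gaps above \<open>e k\<close> kill \<open>x i\<close> for \<open>i > k\<close>. So
    \<open>u\<close> is a multiple of \<open>v k\<close> with zero first entry, which forces
    \<open>x k = 0\<close>.\<close>
  have "u $ 0 = 0" using Q0[of 0] less k by auto
  have xi: "x i = 0" if "i \<in> {k<..n}" for i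
    using P0[of i] that k pos_v[of i] strict_mono_onD[OF mono, of k i] by auto
  have "u $ 0 = (\<Sum>i\<in>{k..n}. x i * v i $ 0)" using k by (simp add: u_def)
  also have "\<dots> = x k * v k $ 0" using k xi by (subst sum.head) auto
  finally have "x k = 0"
    using \<open>u $ 0 = 0\<close> schroedinger_eigenvector_first_nonzero[OF v[OF k]] by simp
  have x_ge: "x i = 0" if "i \<in> {k..n}" for i
    using xi[of i] \<open>x k = 0\<close> that by (cases "i = k") auto
  \<comment> \<open>Now \<open>u = 0\<close>, and its squared norm in the other expansion forces the
    remaining coefficients to vanish.\<close>
  hence uu: "(\<Sum>c<k. (x c)\<^sup>2 * (w (c + 1) \<bullet> w (c + 1))) = 0"
    unfolding uB(1)[symmetric] by (simp add: uA)
  have W: "0 \<le> (x c)\<^sup>2 * (w (c + 1) \<bullet> w (c + 1))" if "c < k" for c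
    using pos_w[of "c + 1"] that k by (intro mult_nonneg_nonneg) auto
  have "(x c)\<^sup>2 * (w (c + 1) \<bullet> w (c + 1)) = 0" if "c < k" for c
    by (rule sum_nonneg_0[OF finite_lessThan W uu]) (use that in simp_all)
  hence "x c = 0" if "c < k" for c
    using pos_w[of "c + 1"] that k by fastforce
  with x_ge i0 show False by (metis atLeastAtMost_iff not_le)
qed

section \<open>Common eigenvalues of the free and the perturbed matrix\<close>

lemma schroedinger_mat2_common_eigenvalue:
  assumes n: "n \<ge> 2" and "eigenvalue (free_schroedinger_mat n) x"
    and "eigenvalue (schroedinger_mat2 n b1 b2) x"
  shows "b1 + b2 * x * (x - b1) = 0"
proof -
  let ?d = "\<lambda>j::nat. if j = 1 then b1 else if j = 2 then b2 else 0"
  let ?A = "schroedinger_mat n (\<lambda>_. 0)" and ?B = "schroedinger_mat n ?d"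
  obtain v w where v: "eigenvector ?A v x" and w: "eigenvector ?B w x"
    using assms by (auto simp: eigenvalue_def free_schroedinger_mat_def schroedinger_mat2_def)
  hence vc: "v \<in> carrier_vec n" "?A *\<^sub>v v = x \<cdot>\<^sub>v v" and wc: "w \<in> carrier_vec n" "?B *\<^sub>v w = x \<cdot>\<^sub>v w"
    by (auto simp: eigenvector_def schroedinger_mat_def)
  \<comment> \<open>Both terms equal \<open>x * (v \<bullet> w)\<close>: the first because
    \<open>w\<close> is an eigenvector of \<open>?B\<close>, the second by moving \<open>?A\<close>
    onto \<open>v\<close>.\<close>
  have "v \<bullet> (?B *\<^sub>v w) - v \<bullet> (?A *\<^sub>v w) = 0"
    using symmetric_mat_scalar_prod[OF schroedinger_mat_carrier transpose_schroedinger_mat vc(1) wc(1),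
        of "\<lambda>_. 0"] vc wc by simp
  hence "(\<Sum>r<n. ?d (r + 1) * (v $ r * w $ r)) = 0"
    using schroedinger_quadratic_form_diff[OF vc(1) wc(1), of ?d "\<lambda>_. 0"] by simp
  also have "(\<Sum>r<n. ?d (r + 1) * (v $ r * w $ r)) = (\<Sum>r<2. ?d (r + 1) * (v $ r * w $ r))"
    using n by (intro sum.mono_neutral_right) auto
  finally have "b1 * (v $ 0 * w $ 0) + b2 * (v $ 1 * w $ 1) = 0"
    by (simp add: numeral_2_eq_2)
  \<comment> \<open>The first row of each eigenvalue equation, which leaves the nonzero common
    factor \<open>v $ 0 * w $ 0\<close>.\<close>
  moreover have "v $ 1 = x * v $ 0" "w $ 1 = (x - b1) * w $ 0"
    using schroedinger_eigenvector_eq[OF v, of 0] schroedinger_eigenvector_eq[OF w, of 0] n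
    by (auto simp: algebra_simps)
  ultimately have "b1 * (v $ 0 * w $ 0) + b2 * ((x * v $ 0) * ((x - b1) * w $ 0)) = 0"
    by simp
  hence "(b1 + b2 * x * (x - b1)) * (v $ 0 * w $ 0) = 0"
    by (simp add: algebra_simps)
  thus ?thesis
    using schroedinger_eigenvector_first_nonzero[OF v] schroedinger_eigenvector_first_nonzero[OF w]
    by simp
qed

text \<open>The reflections \<open>- e k > 0\<close> and \<open>- e (k + 1) < 0\<close> are
  eigenvalues too, and none lies strictly between \<open>e k\<close> and \<open>e (k + 1)\<close>.
  Hence \<open>- e k \<ge> e (k + 1)\<close> and \<open>- e (k + 1) \<le> e k\<close>, which bound
  the sum from both sides.\<close>

lemma free_schroedinger_consecutive_opposite:
  assumes e: "lists_eigenvalues n (free_schroedinger_mat n) e" and k: "k \<in> {1..n - 1}"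
    and "e k < 0" "0 < e (k + 1)"
  shows "e k + e (k + 1) = 0"
proof -
  have mono: "strict_mono_on {1..n} e" and range: "e ` {1..n} = {x. eigenvalue (free_schroedinger_mat n) x}"
    using e by (auto simp: lists_eigenvalues_def)
  have refl: "\<exists>j\<in>{1..n}. e j = - e i" if "i \<in> {1..n}" for i
  proof -
    have "eigenvalue (free_schroedinger_mat n) (e i)" using range that by blast
    hence "eigenvalue (free_schroedinger_mat n) (- e i)"
      using eigenvalue_schroedinger_neg[of n "\<lambda>_. 0" "e i"]
      by (simp add: free_schroedinger_mat_def)
    hence "- e i \<in> e ` {1..n}" using range by simp
    thus ?thesis by (metis imageE)
  qed
  have gap: "e j \<le> e k \<or> e (k + 1) \<le> e j" if "j \<in> {1..n}" for j
    using strict_mono_on_leD[OF mono, of j k] strict_mono_on_leD[OF mono, of "k + 1" j] that k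
    by (cases "j \<le> k") auto
  from k have "k \<in> {1..n}" "k + 1 \<in> {1..n}" by auto
  then obtain i j where "i \<in> {1..n}" "e i = - e k" "j \<in> {1..n}" "e j = - e (k + 1)"
    using refl by metis
  thus ?thesis using gap[of i] gap[of j] assms(3,4) by linarith
qed

theorem theorem4p2:
  fixes n k :: nat and b1 b2 :: real and lam lam' :: "nat \<Rightarrow> real"
  assumes "n \<ge> 2"
    and "lists_eigenvalues n (free_schroedinger_mat n) lam"
    and "lists_eigenvalues n (schroedinger_mat2 n b1 b2) lam'"
    and "k \<in> {1..n - 1}"
    and "lam k = lam' k"
    and "lam (k + 1) = lam' (k + 1)"
  shows "b1 = 0 \<and> b2 = 0 \<and> schroedinger_mat2 n b1 b2 = free_schroedinger_mat n"
proof -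
  let ?x = "lam k" and ?y = "lam (k + 1)"
  have k: "k \<in> {1..n}" "k + 1 \<in> {1..n}" using assms(4) by auto
  have ev: "eigenvalue (free_schroedinger_mat n) (lam i)" "eigenvalue (schroedinger_mat2 n b1 b2) (lam' i)"
    if "i \<in> {1..n}" for i
    using assms(2,3) that by (auto simp: lists_eigenvalues_def)
  have x: "b1 + b2 * ?x * (?x - b1) = 0" and y: "b1 + b2 * ?y * (?y - b1) = 0"
    using schroedinger_mat2_common_eigenvalue[OF assms(1)] ev[OF k(1)] ev[OF k(2)] assms(5,6)
    by simp_all
  have xy: "?x < ?y"
    using assms(2) k by (auto simp: lists_eigenvalues_def intro: strict_mono_onD)
  have "b2 = 0"
  proof (rule ccontr)
    assume b2: "b2 \<noteq> 0"
    \<comment> \<open>The difference of the two equations \<open>x\<close> and \<open>y\<close>,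
      factored.\<close>
    have "b2 * (?x - ?y) * (?x + ?y - b1) = 0"
      using x y by (simp add: algebra_simps)
    hence sum: "?x + ?y = b1" using b2 xy by simp
    \<comment> \<open>By \<open>sum\<close>, the factor \<open>?x - b1\<close> is
      \<open>- ?y\<close>.\<close>
    have prod: "b1 = b2 * (?x * ?y)"
      using x unfolding sum[symmetric] by (simp add: algebra_simps)
    have "b1 \<noteq> 0"
    proof
      assume "b1 = 0"
      hence "?x = 0 \<or> ?y = 0" using prod b2 by simp
      thus False using sum xy \<open>b1 = 0\<close> by auto
    qed
    have "\<not> (?x < 0 \<and> 0 < ?y)"
      using free_schroedinger_consecutive_opposite[OF assms(2,4)] sum \<open>b1 \<noteq> 0\<close> by auto
    moreover have "?x \<noteq> 0" "?y \<noteq> 0" using prod \<open>b1 \<noteq> 0\<close> by auto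
    ultimately have "0 < ?x * ?y" using xy by (auto simp: zero_less_mult_iff)
    hence "(0 < b1 \<and> 0 < b2) \<or> (b1 < 0 \<and> b2 < 0)"
      using prod b2 by (metis mult_pos_pos mult_neg_pos linorder_neqE_linordered_idom)
    thus False
    proof
      assume "0 < b1 \<and> 0 < b2"
      hence "lam k < lam' k"
        using schroedinger_eigenvalue_strict_mono[OF assms(2)[unfolded free_schroedinger_mat_def]
            assms(3)[unfolded schroedinger_mat2_def] _ _ k(1)] by auto
      with assms(5) show False by simp
    next
      assume "b1 < 0 \<and> b2 < 0"
      \<comment> \<open>The roles are exchanged: here the zero diagonal dominates the perturbed
        one.\<close>
      hence "lam' k < lam k"
        using schroedinger_eigenvalue_strict_mono[OF assms(3)[unfolded schroedinger_mat2_def]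
            assms(2)[unfolded free_schroedinger_mat_def] _ _ k(1)] by auto
      with assms(5) show False by simp
    qed
  qed
  moreover from this have "b1 = 0" using x by simp
  moreover have "schroedinger_mat2 n 0 0 = free_schroedinger_mat n"
    by (simp add: schroedinger_mat2_def free_schroedinger_mat_def if_distrib cong: if_cong)
  ultimately show ?thesis by simp
qed

end
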